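(* Let $\lambda>0$ and $y_i=\theta^*_i+\epsilon_i$, $1\le i\le n$, where $\theta^*\in\mathbb{R}^n$ is piecewise constant with $K$ pieces (see context) and $\epsilon_1,\dots,\epsilon_n$ are i.i.d. with mean zero and sub-Gaussian with parameter $\sigma>0$. Let $$\hat\theta=\arg\min_{\theta\in\mathbb{R}^n}\ \frac12\sum_{i=1}^n(y_i-\theta_i)^2+\lambda\sum_{i=1}^{n-1}|\theta_i-\theta_{i+1}|.$$ Fix any $i\in\{1,\dots,n\}$. Then for every $\delta\in(0,\tfrac{\log2}{e})$, $$\Pr\big(|\hat\theta_i-\theta^*_i|>B_{i,\delta}\big)\le 2\Big(1+\frac{24}{(\log2)^2}\Big)\delta^2,$$ where $$B_{i,\delta}=4\sigma\left(\sqrt{\frac{\log\log(2\max(3,d_i))}{\max(3,d_i)}}+\sqrt{\frac{\log\frac1\delta}{d_i}}\right)+4\sigma^2\,\frac{\log\log(2m_{k(i)})+\log\frac1\delta}{\lambda}+\frac{2\sqrt{m_{k(i)}\sigma^2\log\frac1\delta}+2\lambda}{m_{k(i)}}.$$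
   Context: A random variable $X$ is sub-Gaussian with parameter $\sigma$ if $\mathbb{E}[e^{s(X-\mathbb{E}X)}]\le e^{\sigma^2s^2/2}$ for all $s\in\mathbb{R}$. $\theta^*$ is piecewise constant with $K$ pieces: there are integers $1=n_1<n_2<\cdots<n_K<n$, with the convention $n_{K+1}=n+1$, such that $\theta^*_{n_k}=\theta^*_{n_k+1}=\cdots=\theta^*_{n_{k+1}-1}$ for each $1\le k\le K$. The length of the $k$-th piece is $m_k=n_{k+1}-n_k$. For $i\in\{1,\dots,n\}$, $k(i)$ is the index of the piece containing $i$, i.e. $n_{k(i)}\le i\le n_{k(i)+1}-1$, and $d_i=\min(i+1-n_{k(i)},\,n_{k(i)+1}-i)$. $\log$ is the natural logarithm. *)

theory Defs
  imports "HOL-Probability.Probability"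
begin

text \<open>
  A vector in \<open>\<real>\<^sup>n\<close> is a function on the naturals of which only the entries at \<open>1, \<dots>, n\<close>
  are ever used.
\<close>

text \<open>
  The Bochner integral of a non-integrable function is \<open>0\<close>, so finiteness of the mean and of
  the moment generating function has to be required explicitly.
\<close>

definition sub_gaussian :: "'a measure \<Rightarrow> real \<Rightarrow> ('a \<Rightarrow> real) \<Rightarrow> bool" where
  "sub_gaussian M \<sigma> X \<longleftrightarrow>
     integrable M X \<and>
     (\<forall>s::real. integrable M (\<lambda>\<omega>. exp (s * (X \<omega> - integral\<^sup>L M X))) \<and>
        integral\<^sup>L M (\<lambda>\<omega>. exp (s * (X \<omega> - integral\<^sup>L M X))) \<le> exp (\<sigma>\<^sup>2 * s\<^sup>2 / 2))"

definition piecewise_constant :: "nat \<Rightarrow> nat \<Rightarrow> (nat \<Rightarrow> nat) \<Rightarrow> (nat \<Rightarrow> real) \<Rightarrow> bool" where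
  "piecewise_constant n K N \<theta> \<longleftrightarrow>
     1 \<le> K \<and> N 1 = 1 \<and> strict_mono_on {1..K} N \<and> N K < n \<and> N (K + 1) = n + 1 \<and>
     (\<forall>k\<in>{1..K}. \<forall>j\<in>{N k..<N (k + 1)}. \<theta> j = \<theta> (N k))"

definition piece_length :: "(nat \<Rightarrow> nat) \<Rightarrow> nat \<Rightarrow> nat" where
  "piece_length N k = N (k + 1) - N k"

definition piece_index :: "nat \<Rightarrow> (nat \<Rightarrow> nat) \<Rightarrow> nat \<Rightarrow> nat" where
  "piece_index K N i = (THE k. k \<in> {1..K} \<and> N k \<le> i \<and> i \<le> N (k + 1) - 1)"

definition boundary_dist :: "nat \<Rightarrow> (nat \<Rightarrow> nat) \<Rightarrow> nat \<Rightarrow> nat" where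
  "boundary_dist K N i =
     min (i + 1 - N (piece_index K N i)) (N (piece_index K N i + 1) - i)"

definition tv_objective :: "nat \<Rightarrow> real \<Rightarrow> (nat \<Rightarrow> real) \<Rightarrow> (nat \<Rightarrow> real) \<Rightarrow> real" where
  "tv_objective n lam y \<theta> =
     1 / 2 * (\<Sum>j=1..n. (y j - \<theta> j)\<^sup>2) + lam * (\<Sum>j=1..n - 1. \<bar>\<theta> j - \<theta> (j + 1)\<bar>)"

definition error_bound :: "real \<Rightarrow> real \<Rightarrow> real \<Rightarrow> nat \<Rightarrow> nat \<Rightarrow> real" where
  "error_bound \<sigma> lam \<delta> d m =
     4 * \<sigma> * (sqrt (ln (ln (2 * real (max 3 d))) / real (max 3 d)) + sqrt (ln (1 / \<delta>) / real d))
     + 4 * \<sigma>\<^sup>2 * ((ln (ln (2 * real m)) + ln (1 / \<delta>)) / lam)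
     + (2 * sqrt (real m * \<sigma>\<^sup>2 * ln (1 / \<delta>)) + 2 * lam) / real m"

lemma piece_index_unique:
  assumes "piecewise_constant n K N \<theta>" and "i \<in> {1..n}"
  shows "\<exists>!k. k \<in> {1..K} \<and> N k \<le> i \<and> i \<le> N (k + 1) - 1"
proof -
  have K: "1 \<le> K" "N 1 = 1" "N K < n" "N (K + 1) = n + 1"
    and mono: "\<And>a b. a \<in> {1..K} \<Longrightarrow> b \<in> {1..K} \<Longrightarrow> a < b \<Longrightarrow> N a < N b"
    using assms(1) by (auto simp: piecewise_constant_def strict_mono_on_def)
  have next_le: "N (a + 1) \<le> N b" if "a \<in> {1..K}" "b \<in> {1..K}" "a < b" for a b
    using that mono[of "a + 1" b] by (cases "b = a + 1") auto
  define S where "S = {k \<in> {1..K}. N k \<le> i}"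
  have S: "finite S" "1 \<in> S" using K assms(2) by (auto simp: S_def)
  define k where "k = Max S"
  have kS: "k \<in> S" using S Max_in unfolding k_def by blast
  have "i < N (k + 1)"
  proof (rule ccontr)
    assume *: "\<not> i < N (k + 1)"
    then have "k \<noteq> K" using K assms(2) by auto
    then have "k + 1 \<in> S" using * kS by (auto simp: S_def)
    then have "k + 1 \<le> k" using S(1) Max_ge[of S "k + 1"] unfolding k_def by blast
    then show False by simp
  qed
  then have "k \<in> {1..K} \<and> N k \<le> i \<and> i \<le> N (k + 1) - 1"
    using kS by (auto simp: S_def)
  moreover have "a = b"
    if a: "a \<in> {1..K} \<and> N a \<le> i \<and> i \<le> N (a + 1) - 1"
      and b: "b \<in> {1..K} \<and> N b \<le> i \<and> i \<le> N (b + 1) - 1" for a b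
  proof -
    have "1 \<le> i" using assms(2) by simp
    then show ?thesis
      using a b next_le[of a b] next_le[of b a] by (cases a b rule: linorder_cases) auto
  qed
  ultimately show ?thesis by blast
qed

end

theory Submission
  imports Defs
begin

text \<open>
  The estimator is only compared with perturbations of itself that are constant on an interval.
  Suppose that \<open>\<theta>hat i\<close> exceeds the true value \<open>\<theta> i\<close>, and take the maximal interval \<open>J\<close> around \<open>i\<close>,
  inside the piece of \<open>i\<close>, on which \<open>\<theta>hat\<close> is at least \<open>\<theta>hat i\<close>. Lowering \<open>\<theta>hat\<close> slightly on \<open>J\<close>
  cannot decrease the objective (\<open>tv_lower_interval\<close>). As the signal is constant on \<open>J\<close>, this says
  that the noise summed over \<open>J\<close> is at least \<open>card J * (\<theta>hat i - \<theta> i)\<close> plus one correction for each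
  end of \<open>J\<close>: it is \<open>lam\<close> if the end is not an end of the piece, because \<open>\<theta>hat\<close> jumps down there and
  lowering it reduces the total variation; at an end of the piece, where lowering may increase the
  total variation, it is \<open>- lam\<close>.

  If \<open>J\<close> is the whole piece, a sub-Gaussian tail bound for one sum gives the last summand of the
  error bound. If \<open>J\<close> touches exactly one end of the piece, the two contributions of \<open>lam\<close> cancel,
  \<open>J\<close> has at least \<open>d\<close> points, and the noise is a random walk started at a fixed point, which a
  finite law of the iterated logarithm controls at all times simultaneously; this gives the first
  summand. If \<open>J\<close> lies strictly inside the piece, it is split at \<open>i\<close> into two walks started at \<open>i\<close>,
  and the surplus of \<open>2 * lam\<close> absorbs the fluctuations of both by the inequality of arithmetic and
  geometric means; this gives the middle summand. The case distinction is \<open>tv_error_upper\<close>.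

  The law of the iterated logarithm (\<open>finite_lil_upper\<close>) follows from a maximal inequality
  on dyadic blocks of time and a union bound over the blocks. The maximal inequality comes from
  Ville's inequality for the exponential supermartingale (\<open>ville_exp_sum\<close>). The lower error bound
  follows by negating data, noise and estimator. Altogether eight walks and two sums are controlled,
  which fails with probability at most \<open>2 * \<delta>\<^sup>2 + 16 * (\<delta> / ln 2) ^ 4\<close>.
\<close>

section \<open>The Ville inequality for independent sums\<close>

lemma (in prob_space) indep_vars_reindex:
  assumes indep: "indep_vars M' X I" and \<pi>: "inj_on \<pi> J" "\<pi> ` J \<subseteq> I"
  shows "indep_vars (\<lambda>r. M' (\<pi> r)) (\<lambda>r. X (\<pi> r)) J"
  unfolding indep_vars_def2
proof (intro conjI ballI indep_setsI)
  let ?F = "\<lambda>i. {X i -` A \<inter> space M |A. A \<in> sets (M' i)}"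
  from indep have F: "indep_sets ?F I" and rv: "\<And>i. i \<in> I \<Longrightarrow> random_variable (M' i) (X i)"
    by (auto simp: indep_vars_def2)
  show "random_variable (M' (\<pi> r)) (X (\<pi> r))" if "r \<in> J" for r
    using rv that \<pi>(2) by auto
  show "?F (\<pi> r) \<subseteq> events" if "r \<in> J" for r
    using rv[of "\<pi> r"] that \<pi>(2) by (auto intro: measurable_sets)
  fix A L assume L: "L \<noteq> {}" "L \<subseteq> J" "finite L" and A: "\<forall>r\<in>L. A r \<in> ?F (\<pi> r)"
  define B where "B i = A (the_inv_into J \<pi> i)" for i
  have B: "B (\<pi> r) = A r" if "r \<in> L" for r
    using the_inv_into_f_f[OF \<pi>(1), of r] that L(2) by (auto simp: B_def)
  have inj: "inj_on \<pi> L" using \<pi>(1) L(2) by (rule inj_on_subset)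
  have "prob (\<Inter>i\<in>\<pi> ` L. B i) = (\<Prod>i\<in>\<pi> ` L. prob (B i))"
    using L \<pi>(2) A B by (intro indep_setsD[OF F]) auto
  then show "prob (\<Inter>r\<in>L. A r) = (\<Prod>r\<in>L. prob (A r))"
    using B by (simp add: prod.reindex[OF inj])
qed

text \<open>
  The one-step supermartingale property: since \<open>Y t\<close> is independent of everything that is a
  function \<open>g\<close> of the past, multiplying by \<open>exp (Y t)\<close> does not increase expectations.
\<close>

lemma (in prob_space) indep_exp_product_le:
  fixes Y :: "nat \<Rightarrow> 'a \<Rightarrow> real"
  assumes indep: "indep_vars (\<lambda>_. borel) Y {..<Suc t}"
    and le1: "(\<integral>\<^sup>+\<omega>. ennreal (exp (Y t \<omega>)) \<partial>M) \<le> 1"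
    and g: "g \<in> borel_measurable (PiM {..<t} (\<lambda>_. borel))"
  shows "(\<integral>\<^sup>+\<omega>. g (restrict (\<lambda>r. Y r \<omega>) {..<t}) * ennreal (exp (Y t \<omega>)) \<partial>M)
         \<le> (\<integral>\<^sup>+\<omega>. g (restrict (\<lambda>r. Y r \<omega>) {..<t}) \<partial>M)"
proof -
  let ?H = "\<lambda>\<omega>. g (restrict (\<lambda>r. Y r \<omega>) {..<t})"
  let ?E = "\<lambda>\<omega>. ennreal (exp (Y t \<omega>))"
  have "indep_var
      borel (g \<circ> (\<lambda>\<omega>. restrict (\<lambda>r. Y r \<omega>) {..<t}))
      borel ((\<lambda>f. ennreal (exp (f t))) \<circ> (\<lambda>\<omega>. restrict (\<lambda>r. Y r \<omega>) {t}))"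
    using g by (intro indep_var_compose[OF indep_var_restrict[OF indep]]) auto
  also have "g \<circ> (\<lambda>\<omega>. restrict (\<lambda>r. Y r \<omega>) {..<t}) = ?H" by auto
  also have "(\<lambda>f. ennreal (exp (f t))) \<circ> (\<lambda>\<omega>. restrict (\<lambda>r. Y r \<omega>) {t}) = ?E" by auto
  finally have "indep_vars (\<lambda>_. borel) (case_bool ?H ?E) UNIV"
    unfolding indep_var_def by (rule indep_vars_cong[THEN iffD1, rotated -1]) (auto split: bool.split)
  from indep_vars_nn_integral[OF _ this]
  have "(\<integral>\<^sup>+\<omega>. ?H \<omega> * ?E \<omega> \<partial>M) = (\<integral>\<^sup>+\<omega>. ?H \<omega> \<partial>M) * (\<integral>\<^sup>+\<omega>. ?E \<omega> \<partial>M)"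
    by (simp add: UNIV_bool mult.commute)
  also have "\<dots> \<le> (\<integral>\<^sup>+\<omega>. ?H \<omega> \<partial>M) * 1"
    by (intro mult_left_mono le1) auto
  finally show ?thesis by simp
qed

text \<open>
  The process \<open>exp (\<Sum>r<t. Y r)\<close> is a nonnegative supermartingale started at \<open>1\<close>. Stopped when
  it first reaches \<open>exp x\<close>, it still has mean at most \<open>1\<close>, and it is at least \<open>exp x\<close> wherever it
  has been stopped. The set \<open>A t\<close> in the proof collects the outcomes not yet stopped at time \<open>t\<close>,
  and the left-hand side of the invariant \<open>main\<close> is the mean of the process that is reset to the
  smaller value \<open>exp x\<close> on being stopped.
\<close>

lemma (in prob_space) ville_exp_sum:
  fixes Y :: "nat \<Rightarrow> 'a \<Rightarrow> real"
  assumes indep: "indep_vars (\<lambda>_. borel) Y {..<T}"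
    and le1: "\<And>t. t < T \<Longrightarrow> (\<integral>\<^sup>+\<omega>. ennreal (exp (Y t \<omega>)) \<partial>M) \<le> 1"
  shows "prob {\<omega>\<in>space M. \<exists>t\<in>{1..T}. x \<le> (\<Sum>r<t. Y r \<omega>)} \<le> exp (- x)"
proof -
  have Ym: "Y r \<in> borel_measurable M" if "r < T" for r
    using indep that by (auto simp: indep_vars_def)
  have Sm[measurable]: "(\<lambda>\<omega>. \<Sum>r<t. Y r \<omega>) \<in> borel_measurable M" if "t \<le> T" for t
    using that by (intro borel_measurable_sum Ym) auto
  define A where "A t = {\<omega>\<in>space M. \<forall>u\<in>{1..t}. (\<Sum>r<u. Y r \<omega>) < x}" for t
  have Am: "A t \<in> sets M" if "t \<le> T" for t
    unfolding A_def using that by (intro sets.sets_Collect_finite_All borel_measurable_less Sm) auto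
  have main: "ennreal (exp x) * emeasure M (space M - A t)
      + (\<integral>\<^sup>+\<omega>. indicator (A t) \<omega> * ennreal (exp (\<Sum>r<t. Y r \<omega>)) \<partial>M) \<le> 1" if "t \<le> T" for t
    using that
  proof (induction t)
    case 0
    then show ?case by (simp add: A_def emeasure_space_1)
  next
    case (Suc t)
    \<comment> \<open>The stopped integrand as a function of the first \<open>t\<close> increments alone, so that
      independence of \<open>Y t\<close> from the past applies to it.\<close>
    define g :: "(nat \<Rightarrow> real) \<Rightarrow> ennreal" where
      "g f = indicator {f. \<forall>u\<in>{1..t}. (\<Sum>r<u. f r) < x} f * ennreal (exp (\<Sum>r<t. f r))" for f
    have gm: "g \<in> borel_measurable (PiM {..<t} (\<lambda>_. borel))"
    proof -
      have "{f \<in> space (PiM {..<t} (\<lambda>_. borel::real measure)). \<forall>u\<in>{1..t}. (\<Sum>r<u. f r) < x}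
              \<in> sets (PiM {..<t} (\<lambda>_. borel))"
        by (intro sets.sets_Collect_finite_All borel_measurable_less borel_measurable_sum
            measurable_component_singleton) auto
      then show ?thesis unfolding g_def
        by (intro borel_measurable_times_ennreal borel_measurable_indicator')
          (auto simp: Collect_conj_eq Int_commute intro!: measurable_component_singleton)
    qed
    have gH: "g (restrict (\<lambda>r. Y r \<omega>) {..<t})
        = indicator (A t) \<omega> * ennreal (exp (\<Sum>r<t. Y r \<omega>))" if "\<omega> \<in> space M" for \<omega>
    proof -
      have "(\<Sum>r<u. restrict (\<lambda>r. Y r \<omega>) {..<t} r) = (\<Sum>r<u. Y r \<omega>)" if "u \<le> t" for u
        using that by (intro sum.cong) auto
      then show ?thesis using that by (auto simp: g_def A_def indicator_def)
    qed
    \<comment> \<open>The outcomes that are stopped exactly at time \<open>Suc t\<close>.\<close>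
    define C where "C = A t - A (Suc t)"
    have sub: "A (Suc t) \<subseteq> A t" unfolding A_def by auto
    have Cm: "C \<in> sets M" "A t \<in> sets M" "A (Suc t) \<in> sets M"
      using Am Suc.prems by (auto simp: C_def)
    have Cge: "x \<le> (\<Sum>r<Suc t. Y r \<omega>)" if "\<omega> \<in> C" for \<omega>
      using that unfolding C_def A_def by (fastforce simp: le_Suc_eq not_less)
    have eS: "exp (\<Sum>r<Suc t. Y r \<omega>) = exp (\<Sum>r<t. Y r \<omega>) * exp (Y t \<omega>)" for \<omega>
      by (simp add: exp_add)
    have "ennreal (exp x) * emeasure M C
        + (\<integral>\<^sup>+\<omega>. indicator (A (Suc t)) \<omega> * ennreal (exp (\<Sum>r<Suc t. Y r \<omega>)) \<partial>M)
      = (\<integral>\<^sup>+\<omega>. ennreal (exp x) * indicator C \<omega>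
          + indicator (A (Suc t)) \<omega> * ennreal (exp (\<Sum>r<Suc t. Y r \<omega>)) \<partial>M)"
      using Cm Sm[OF Suc.prems]
      by (subst nn_integral_add)
        (auto simp: nn_integral_cmult_indicator simp del: sum.lessThan_Suc)
    also have "\<dots> \<le> (\<integral>\<^sup>+\<omega>. indicator (A t) \<omega> * ennreal (exp (\<Sum>r<Suc t. Y r \<omega>)) \<partial>M)"
    proof (rule nn_integral_mono)
      fix \<omega> assume "\<omega> \<in> space M"
      show "ennreal (exp x) * indicator C \<omega>
          + indicator (A (Suc t)) \<omega> * ennreal (exp (\<Sum>r<Suc t. Y r \<omega>))
        \<le> indicator (A t) \<omega> * ennreal (exp (\<Sum>r<Suc t. Y r \<omega>))"
        using Cge[of \<omega>] sub by (auto simp: indicator_def C_def simp del: sum.lessThan_Suc)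
    qed
    also have "\<dots> = (\<integral>\<^sup>+\<omega>. g (restrict (\<lambda>r. Y r \<omega>) {..<t}) * ennreal (exp (Y t \<omega>)) \<partial>M)"
      by (intro nn_integral_cong) (simp only: gH eS ennreal_mult' mult.assoc exp_ge_zero)
    also have "\<dots> \<le> (\<integral>\<^sup>+\<omega>. g (restrict (\<lambda>r. Y r \<omega>) {..<t}) \<partial>M)"
      using Suc.prems indep
      by (intro indep_exp_product_le le1 gm) (auto elim: indep_vars_subset)
    also have "\<dots> = (\<integral>\<^sup>+\<omega>. indicator (A t) \<omega> * ennreal (exp (\<Sum>r<t. Y r \<omega>)) \<partial>M)"
      by (intro nn_integral_cong gH)
    finally have step: "ennreal (exp x) * emeasure M C
        + (\<integral>\<^sup>+\<omega>. indicator (A (Suc t)) \<omega> * ennreal (exp (\<Sum>r<Suc t. Y r \<omega>)) \<partial>M)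
        \<le> (\<integral>\<^sup>+\<omega>. indicator (A t) \<omega> * ennreal (exp (\<Sum>r<t. Y r \<omega>)) \<partial>M)" .
    have "space M - A (Suc t) = (space M - A t) \<union> C"
      using sub by (auto simp: C_def A_def)
    then have "emeasure M (space M - A (Suc t)) = emeasure M (space M - A t) + emeasure M C"
      using Cm by (subst plus_emeasure) (auto simp: C_def)
    then have "ennreal (exp x) * emeasure M (space M - A (Suc t))
        + (\<integral>\<^sup>+\<omega>. indicator (A (Suc t)) \<omega> * ennreal (exp (\<Sum>r<Suc t. Y r \<omega>)) \<partial>M)
        = ennreal (exp x) * emeasure M (space M - A t) + (ennreal (exp x) * emeasure M C
        + (\<integral>\<^sup>+\<omega>. indicator (A (Suc t)) \<omega> * ennreal (exp (\<Sum>r<Suc t. Y r \<omega>)) \<partial>M))"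
      by (simp add: distrib_left add.assoc)
    also have "\<dots> \<le> 1"
      using add_left_mono[OF step] Suc.IH Suc.prems by (meson Suc_leD order_trans)
    finally show ?case .
  qed
  let ?B = "{\<omega>\<in>space M. \<exists>t\<in>{1..T}. x \<le> (\<Sum>r<t. Y r \<omega>)}"
  have B: "?B = space M - A T" by (auto simp: A_def not_less)
  have "ennreal (exp x) * emeasure M (space M - A T) \<le> 1"
    using main[of T] by (meson add_increasing2 dual_order.trans le_add_same_cancel1 order_refl zero_le)
  then have "ennreal (exp x * prob ?B) \<le> ennreal 1"
    unfolding B by (simp add: emeasure_eq_measure ennreal_mult)
  then have "exp x * prob ?B \<le> 1"
    by (subst (asm) ennreal_le_iff) auto
  then show ?thesis by (simp add: exp_minus field_simps)
qed

section \<open>A finite law of the iterated logarithm\<close>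

text \<open>
  Chernoff's method with \<open>ville_exp_sum\<close> in place of Markov's inequality. Crossing the level \<open>z\<close> at
  a time \<open>t \<le> L\<close> forces the exponential walk with slope \<open>s\<close> above \<open>s * z - L * \<sigma>\<^sup>2 * s\<^sup>2 / 2\<close>, which
  \<open>s = z / (\<sigma>\<^sup>2 * L)\<close> maximizes.
\<close>

lemma (in prob_space) subgaussian_maximal_inequality:
  fixes X :: "nat \<Rightarrow> 'a \<Rightarrow> real"
  assumes indep: "indep_vars (\<lambda>_. borel) X {..<T}"
    and mgf: "\<And>t s. t < T \<Longrightarrow>
      (\<integral>\<^sup>+\<omega>. ennreal (exp (s * X t \<omega>)) \<partial>M) \<le> ennreal (exp (\<sigma>\<^sup>2 * s\<^sup>2 / 2))"
    and \<sigma>: "\<sigma> > 0" and z: "z \<ge> 0" and L: "L > 0" "real T \<le> L"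
  shows "prob {\<omega>\<in>space M. \<exists>t\<in>{1..T}. z \<le> (\<Sum>r<t. X r \<omega>)} \<le> exp (- (z\<^sup>2 / (2 * \<sigma>\<^sup>2 * L)))"
proof -
  define s where "s = z / (\<sigma>\<^sup>2 * L)"
  define c where "c = \<sigma>\<^sup>2 * s\<^sup>2 / 2"
  let ?Y = "\<lambda>r \<omega>. s * X r \<omega> - c"
  have s: "s \<ge> 0" and c: "c \<ge> 0" using \<sigma> z L by (auto simp: s_def c_def)
  have Xm: "X r \<in> borel_measurable M" if "r < T" for r
    using indep that by (auto simp: indep_vars_def)
  have Yind: "indep_vars (\<lambda>_. borel) ?Y {..<T}"
    by (rule indep_vars_compose2[OF indep]) simp
  have Ymgf: "(\<integral>\<^sup>+\<omega>. ennreal (exp (?Y t \<omega>)) \<partial>M) \<le> 1" if t: "t < T" for t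
  proof -
    have "(\<integral>\<^sup>+\<omega>. ennreal (exp (?Y t \<omega>)) \<partial>M)
        = (\<integral>\<^sup>+\<omega>. ennreal (exp (- c)) * ennreal (exp (s * X t \<omega>)) \<partial>M)"
      by (intro nn_integral_cong) (simp add: ennreal_mult[symmetric] mult_exp_exp)
    also have "\<dots> = ennreal (exp (- c)) * (\<integral>\<^sup>+\<omega>. ennreal (exp (s * X t \<omega>)) \<partial>M)"
      using Xm[OF t] by (intro nn_integral_cmult measurable_compose[OF _ measurable_ennreal]) simp
    also have "\<dots> \<le> ennreal (exp (- c)) * ennreal (exp c)"
      unfolding c_def by (intro mult_left_mono mgf t) auto
    also have "\<dots> = 1" by (simp add: ennreal_mult[symmetric] mult_exp_exp)
    finally show ?thesis .
  qed
  have Sm: "(\<lambda>\<omega>. \<Sum>r<t. ?Y r \<omega>) \<in> borel_measurable M" if "t \<le> T" for t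
    using that by (intro borel_measurable_sum borel_measurable_diff borel_measurable_times Xm) auto
  have zs: "s * z - L * c = z\<^sup>2 / (2 * \<sigma>\<^sup>2 * L)"
    using \<sigma> L by (simp add: s_def c_def field_simps power2_eq_square)
  have "prob {\<omega>\<in>space M. \<exists>t\<in>{1..T}. z \<le> (\<Sum>r<t. X r \<omega>)}
      \<le> prob {\<omega>\<in>space M. \<exists>t\<in>{1..T}. z\<^sup>2 / (2 * \<sigma>\<^sup>2 * L) \<le> (\<Sum>r<t. ?Y r \<omega>)}"
  proof (rule finite_measure_mono, safe)
    fix \<omega> t assume t: "t \<in> {1..T}" "z \<le> (\<Sum>r<t. X r \<omega>)"
    have "s * z \<le> s * (\<Sum>r<t. X r \<omega>)" using s t by (intro mult_left_mono) auto
    moreover have "real t * c \<le> L * c" using t c L by (intro mult_right_mono) auto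
    ultimately have "s * z - L * c \<le> (\<Sum>r<t. ?Y r \<omega>)"
      by (simp add: sum_subtractf sum_distrib_left)
    then show "\<exists>t\<in>{1..T}. z\<^sup>2 / (2 * \<sigma>\<^sup>2 * L) \<le> (\<Sum>r<t. ?Y r \<omega>)" using t zs by auto
  next
    show "{\<omega>\<in>space M. \<exists>t\<in>{1..T}. z\<^sup>2 / (2 * \<sigma>\<^sup>2 * L) \<le> (\<Sum>r<t. ?Y r \<omega>)} \<in> sets M"
      by (intro sets.sets_Collect_finite_Ex borel_measurable_le Sm) auto
  qed
  also have "\<dots> \<le> exp (- (z\<^sup>2 / (2 * \<sigma>\<^sup>2 * L)))"
    by (rule ville_exp_sum[OF Yind Ymgf])
  finally show ?thesis .
qed

definition lil_bound :: "real \<Rightarrow> real \<Rightarrow> nat \<Rightarrow> real" where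
  "lil_bound \<sigma> \<delta> t = 4 * \<sigma> * sqrt (real t * ln (ln (2 * real t) / \<delta>))"

lemma sum_inverse_fourth_power_le: "(\<Sum>k<n. 1 / real (k + 1) ^ 4) \<le> 2"
proof -
  have "(\<Sum>k<Suc n. 1 / real (k + 1) ^ 4) \<le> 2 - 1 / real (n + 1)" for n
  proof (induction n)
    case (Suc n)
    have "1 / real (Suc n + 1) ^ 4 \<le> 1 / (real (n + 1) * real (n + 2))"
    proof (rule divide_left_mono)
      have "real (n + 1) * real (n + 2) \<le> real (n + 2) ^ 2"
        by (simp add: power2_eq_square)
      also have "\<dots> \<le> real (n + 2) ^ 4" by (rule power_increasing) auto
      finally show "real (n + 1) * real (n + 2) \<le> real (Suc n + 1) ^ 4" by simp
    qed auto
    also have "\<dots> = 1 / real (n + 1) - 1 / real (n + 2)" by (simp add: field_simps)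
    finally show ?case using Suc by simp
  qed simp
  from this[of n] have "(\<Sum>k<Suc n. 1 / real (k + 1) ^ 4) \<le> 2"
    by (rule order_trans) simp
  moreover have "0 \<le> 1 / real (n + 1) ^ 4" by simp
  ultimately show ?thesis by (simp only: sum.lessThan_Suc)
qed

text \<open>
  The times are split into dyadic blocks \<open>2 ^ k \<le> t < 2 ^ (k + 1)\<close>. On a block the barrier is at
  least its value \<open>z k\<close> at \<open>2 ^ k\<close>, and the maximal inequality up to time \<open>2 ^ (k + 1)\<close> bounds the
  probability of reaching it by \<open>exp (- 4 * q k)\<close>. Because \<open>q k\<close> is the logarithm of
  \<open>(k + 1) * ln 2 / \<delta>\<close>, this is a multiple of \<open>1 / (k + 1) ^ 4\<close> and the union bound over the
  blocks converges independently of \<open>T\<close>. The restriction \<open>\<delta> \<le> ln 2\<close> keeps the numbers under the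
  square roots nonnegative already in the first block.
\<close>

lemma (in prob_space) finite_lil_upper:
  fixes X :: "nat \<Rightarrow> 'a \<Rightarrow> real"
  assumes indep: "indep_vars (\<lambda>_. borel) X {..<T}"
    and mgf: "\<And>t s. t < T \<Longrightarrow>
      (\<integral>\<^sup>+\<omega>. ennreal (exp (s * X t \<omega>)) \<partial>M) \<le> ennreal (exp (\<sigma>\<^sup>2 * s\<^sup>2 / 2))"
    and \<sigma>: "\<sigma> > 0" and \<delta>: "0 < \<delta>" "\<delta> \<le> ln 2"
  shows "prob {\<omega>\<in>space M. \<exists>t\<in>{1..T}. lil_bound \<sigma> \<delta> t < (\<Sum>r<t. X r \<omega>)} \<le> 2 * (\<delta> / ln 2) ^ 4"
proof -
  have Xm: "X r \<in> borel_measurable M" if "r < T" for r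
    using indep that by (auto simp: indep_vars_def)
  have Sm: "(\<lambda>\<omega>. \<Sum>r<t. X r \<omega>) \<in> borel_measurable M" if "t \<le> T" for t
    using that by (intro borel_measurable_sum Xm) auto
  define q where "q k = ln (ln (2 * 2 ^ k) / \<delta>)" for k :: nat
  define z where "z k = 4 * \<sigma> * sqrt (2 ^ k * q k)" for k :: nat
  define U where "U k = min T (2 * 2 ^ k)" for k :: nat
  define A where "A k = {\<omega>\<in>space M. \<exists>t\<in>{1..U k}. z k \<le> (\<Sum>r<t. X r \<omega>)}" for k
  have Am: "A k \<in> sets M" for k
    unfolding A_def by (intro sets.sets_Collect_finite_Ex borel_measurable_le Sm) (auto simp: U_def)
  have lnk: "ln (2 * 2 ^ k) = real (k + 1) * ln 2" for k
    by (simp add: ln_mult ln_realpow algebra_simps)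
  have ratio: "1 \<le> ln (2 * 2 ^ k) / \<delta>" for k
  proof -
    have "1 * ln 2 \<le> real (k + 1) * ln (2::real)" by (intro mult_right_mono) auto
    then have "\<delta> \<le> ln (2 * 2 ^ k)" using \<delta> unfolding lnk by linarith
    then show ?thesis using \<delta> by (simp add: le_divide_eq_1_pos)
  qed
  have q: "q k \<ge> 0" for k using ratio[of k] by (simp add: q_def)
  have PA: "prob (A k) \<le> (\<delta> / ln 2) ^ 4 * (1 / real (k + 1) ^ 4)" for k
  proof -
    have "z k \<ge> 0" using \<sigma> q by (simp add: z_def)
    moreover have "U k \<le> T" by (simp add: U_def)
    moreover have "real (U k) \<le> real (2 * 2 ^ k)" unfolding U_def of_nat_le_iff by simp
    ultimately have "prob (A k) \<le> exp (- ((z k)\<^sup>2 / (2 * \<sigma>\<^sup>2 * (2 * 2 ^ k))))"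
      unfolding A_def using \<sigma>
      by (intro subgaussian_maximal_inequality indep_vars_subset[OF indep] mgf) auto
    also have "(z k)\<^sup>2 / (2 * \<sigma>\<^sup>2 * (2 * 2 ^ k)) = 4 * q k"
      using \<sigma> q by (simp add: z_def power_mult_distrib field_simps)
    also have "exp (- (4 * q k)) = exp (- q k) ^ 4"
      by (simp add: exp_of_nat_mult[symmetric])
    also have "exp (- q k) = \<delta> / ln 2 * (1 / real (k + 1))"
      using ratio[of k] \<delta> unfolding q_def by (subst exp_minus, subst exp_ln)
        (auto simp: lnk field_simps intro: less_le_trans)
    finally show ?thesis by (simp only: power_mult_distrib power_one_over)
  qed
  have "{\<omega>\<in>space M. \<exists>t\<in>{1..T}. lil_bound \<sigma> \<delta> t < (\<Sum>r<t. X r \<omega>)} \<subseteq> (\<Union>k<T. A k)"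
  proof safe
    fix \<omega> t assume \<omega>: "\<omega> \<in> space M" and t: "t \<in> {1..T}"
      and gt: "lil_bound \<sigma> \<delta> t < (\<Sum>r<t. X r \<omega>)"
    obtain k where k: "2 ^ k \<le> t" "t < 2 * 2 ^ k"
      using ex_power_ivl1[of 2 t] t by auto
    have "k < T" using k(1) t less_exp[of k] by (simp del: less_exp)
    have k': "2 ^ k \<le> real t" using k(1) by (metis of_nat_le_iff of_nat_numeral of_nat_power)
    have "z k \<le> lil_bound \<sigma> \<delta> t"
    proof -
      have "q k \<le> ln (ln (2 * real t) / \<delta>)"
        unfolding q_def using ratio[of k] \<delta> k'
        by (intro ln_mono divide_right_mono) (auto intro: less_le_trans simp: lnk)
      then show ?thesis unfolding z_def lil_bound_def using \<sigma> k' q[of k]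
        by (intro mult_left_mono real_sqrt_le_mono mult_mono) auto
    qed
    then have "\<omega> \<in> A k" unfolding A_def using \<omega> gt t k
      by (auto simp: U_def intro!: bexI[of _ t])
    then show "\<omega> \<in> (\<Union>k<T. A k)" using \<open>k < T\<close> by auto
  qed
  then have "prob {\<omega>\<in>space M. \<exists>t\<in>{1..T}. lil_bound \<sigma> \<delta> t < (\<Sum>r<t. X r \<omega>)} \<le> prob (\<Union>k<T. A k)"
    by (intro finite_measure_mono) (auto intro: Am)
  also have "\<dots> \<le> (\<Sum>k<T. prob (A k))"
    by (intro finite_measure_subadditive_finite) (auto intro: Am)
  also have "\<dots> \<le> (\<Sum>k<T. (\<delta> / ln 2) ^ 4 * (1 / real (k + 1) ^ 4))"
    by (intro sum_mono PA)
  also have "\<dots> \<le> (\<delta> / ln 2) ^ 4 * 2"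
    unfolding sum_distrib_left[symmetric] using \<delta>
    by (intro mult_left_mono sum_inverse_fourth_power_le) auto
  finally show ?thesis by simp
qed

section \<open>Optimality of the total variation estimator on an interval\<close>

lemma maximal_superlevel_interval:
  fixes f :: "nat \<Rightarrow> real"
  assumes "a \<le> i" "i \<le> b"
  obtains j k where "a \<le> j" "j \<le> i" "i \<le> k" "k \<le> b" "\<And>l. l \<in> {j..k} \<Longrightarrow> f i \<le> f l"
    "j = a \<or> f (j - 1) < f i" "k = b \<or> f (k + 1) < f i"
proof -
  define P where "P j \<longleftrightarrow> a \<le> j \<and> j \<le> i \<and> (\<forall>l\<in>{j..i}. f i \<le> f l)" for j
  define Q where "Q k \<longleftrightarrow> i \<le> k \<and> k \<le> b \<and> (\<forall>l\<in>{i..k}. f i \<le> f l)" for k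
  define j where "j = (LEAST j. P j)"
  define k where "k = (GREATEST k. Q k)"
  have "P i" "Q i" using assms by (auto simp: P_def Q_def)
  have Pj: "P j" unfolding j_def using \<open>P i\<close> by (rule LeastI)
  have Qk: "Q k" unfolding k_def using \<open>Q i\<close> by (rule GreatestI_nat[of _ _ b]) (simp add: Q_def)
  have left: "j = a \<or> f (j - 1) < f i"
  proof (rule ccontr)
    assume *: "\<not> ?thesis"
    have "P (j - 1)" unfolding P_def
    proof (intro conjI ballI)
      fix l assume "l \<in> {j - 1..i}"
      then have "l = j - 1 \<or> l \<in> {j..i}" by auto
      then show "f i \<le> f l" using * Pj by (auto simp: P_def)
    qed (use * Pj in \<open>auto simp: P_def\<close>)
    then have "j \<le> j - 1" unfolding j_def by (rule Least_le)
    then show False using * Pj by (auto simp: P_def)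
  qed
  have right: "k = b \<or> f (k + 1) < f i"
  proof (rule ccontr)
    assume *: "\<not> ?thesis"
    have "Q (k + 1)" using * Qk by (auto simp: Q_def le_Suc_eq)
    then have "k + 1 \<le> k" unfolding k_def by (rule Greatest_le_nat[of _ _ b]) (simp add: Q_def)
    then show False by simp
  qed
  have "f i \<le> f l" if "l \<in> {j..k}" for l
    using that Pj Qk by (cases "l \<le> i") (auto simp: P_def Q_def)
  with left right Pj Qk show ?thesis by (intro that[of j k]) (auto simp: P_def Q_def)
qed

text \<open>
  First-order optimality under lowering \<open>f\<close> by a small amount on \<open>{j..k}\<close>. Each end of the
  interval changes the total variation at rate \<open>1\<close> at most, and at rate \<open>-1\<close> if \<open>f\<close> jumps down
  when leaving the interval there; \<open>cl\<close> and \<open>cr\<close> stand for these rates. An end at \<open>1\<close> or \<open>n\<close>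
  contributes nothing, so that the rate \<open>1\<close> is a valid upper bound there as well.
\<close>

lemma tv_lower_interval:
  fixes f y :: "nat \<Rightarrow> real"
  assumes min: "is_arg_min (tv_objective n lam y) (\<lambda>_. True) f" and lam: "lam \<ge> 0"
    and jk: "1 \<le> j" "j \<le> k" "k \<le> n"
    and cl: "cl = 1 \<or> cl = -1 \<and> 1 < j \<and> f (j - 1) < f j"
    and cr: "cr = 1 \<or> cr = -1 \<and> k < n \<and> f (k + 1) < f k"
  shows "0 \<le> (\<Sum>l=j..k. y l - f l) + lam * (cl + cr)"
proof -
  define A where "A = (\<Sum>l=j..k. y l - f l) + lam * (cl + cr)"
  \<comment> \<open>Up to the step size \<open>h\<close> the jumps at the ends keep their signs.\<close>
  define h where "h = min (if cl = 1 then 1 else f j - f (j - 1)) (if cr = 1 then 1 else f k - f (k + 1))"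
  define p where "p = real (k + 1 - j)"
  have h: "h > 0" using cl cr by (auto simp: h_def)
  have p: "p > 0" using jk by (simp add: p_def)
  have ineq: "0 \<le> A + s * p / 2" if s: "0 < s" "s \<le> h" for s
  proof -
    define g where "g l = (if l \<in> {j..k} then f l - s else f l)" for l
    have obj: "tv_objective n lam y f \<le> tv_objective n lam y g"
      using min by (auto simp: is_arg_min_def not_less)
    have quad: "(\<Sum>l=1..n. (y l - g l)\<^sup>2) = (\<Sum>l=1..n. (y l - f l)\<^sup>2) + 2 * s * (\<Sum>l=j..k. y l - f l) + s\<^sup>2 * p"
    proof -
      have "(\<Sum>l=1..n. (y l - g l)\<^sup>2)
          = (\<Sum>l=1..n. (y l - f l)\<^sup>2 + (if l \<in> {j..k} then 2 * s * (y l - f l) + s\<^sup>2 else 0))"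
        by (intro sum.cong) (auto simp: g_def power2_eq_square algebra_simps)
      also have "\<dots> = (\<Sum>l=1..n. (y l - f l)\<^sup>2) + (\<Sum>l\<in>{1..n} \<inter> {j..k}. 2 * s * (y l - f l) + s\<^sup>2)"
        by (subst sum.distrib) (simp only: sum.inter_restrict finite_atLeastAtMost)
      also have "{1..n} \<inter> {j..k} = {j..k}" using jk by auto
      finally show ?thesis by (simp add: sum.distrib sum_distrib_left p_def mult.commute)
    qed
    have "(\<Sum>l=1..n - 1. \<bar>g l - g (l + 1)\<bar>) \<le> (\<Sum>l=1..n - 1. \<bar>f l - f (l + 1)\<bar>) + s * (cl + cr)"
    proof -
      have "(\<Sum>l=1..n - 1. \<bar>g l - g (l + 1)\<bar>)
          \<le> (\<Sum>l=1..n - 1. \<bar>f l - f (l + 1)\<bar> + (if j - 1 = l then s * cl else 0)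
                + (if k = l then s * cr else 0))"
      proof (rule sum_mono)
        fix l assume l: "l \<in> {1..n - 1}"
        consider "l + 1 = j" | "l = k" | "l + 1 \<noteq> j" "l \<noteq> k" by blast
        then show "\<bar>g l - g (l + 1)\<bar> \<le> \<bar>f l - f (l + 1)\<bar>
            + (if j - 1 = l then s * cl else 0) + (if k = l then s * cr else 0)"
        proof cases
          case 1
          then have "g l = f l" "g (l + 1) = f j - s" "l = j - 1" "k \<noteq> l" using jk by (auto simp: g_def)
          then show ?thesis using cl s 1 by (auto simp: h_def split: if_splits)
        next
          case 2
          then have "g l = f k - s" "g (l + 1) = f (k + 1)" "j - 1 \<noteq> l" using jk l by (auto simp: g_def)
          then show ?thesis using cr s 2 by (auto simp: h_def split: if_splits)
        next
          case 3
          then have "g l - g (l + 1) = f l - f (l + 1)" using jk by (auto simp: g_def)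
          then show ?thesis using 3 l by auto
        qed
      qed
      also have "\<dots> = (\<Sum>l=1..n - 1. \<bar>f l - f (l + 1)\<bar>)
          + (if j - 1 \<in> {1..n - 1} then s * cl else 0) + (if k \<in> {1..n - 1} then s * cr else 0)"
        by (simp only: sum.distrib sum.delta' finite_atLeastAtMost)
      also have "\<dots> \<le> (\<Sum>l=1..n - 1. \<bar>f l - f (l + 1)\<bar>) + s * cl + s * cr"
        using cl cr jk s by (auto simp: not_le)
      finally show ?thesis by (simp add: distrib_left)
    qed
    then have "lam * (\<Sum>l=1..n - 1. \<bar>g l - g (l + 1)\<bar>)
        \<le> lam * ((\<Sum>l=1..n - 1. \<bar>f l - f (l + 1)\<bar>) + s * (cl + cr))"
      using lam by (rule mult_left_mono)
    then have "0 \<le> s * (\<Sum>l=j..k. y l - f l) + s\<^sup>2 * p / 2 + lam * (s * (cl + cr))"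
      using obj unfolding tv_objective_def quad distrib_left[of lam] by argo
    also have "\<dots> = s * (A + s * p / 2)"
      unfolding A_def by (simp add: algebra_simps power2_eq_square)
    finally have "0 \<le> s * (A + s * p / 2)" .
    then show ?thesis using s by (simp add: zero_le_mult_iff)
  qed
  have "0 \<le> A"
  proof (rule ccontr)
    assume "\<not> 0 \<le> A"
    then have neg: "A < 0" by simp
    define s where "s = min h (- A / p)"
    have s: "0 < s" "s \<le> h" "s \<le> - A / p" using h p neg by (auto simp: s_def field_simps)
    then have "s * p \<le> - A" using p by (simp add: field_simps)
    then show False using ineq[OF s(1,2)] neg by simp
  qed
  then show ?thesis by (simp add: A_def)
qed

section \<open>Elementary estimates for the iterated logarithm barrier\<close>

text \<open>
  The next numbers are chosen so that \<open>177 / 100 * (113 / 200) > 1\<close>, which bounds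
  \<open>ln 6 * ln (ln 6)\<close> below by \<open>1\<close>. The margin is small: \<open>ln 6 * ln (ln 6)\<close> is about \<open>1.045\<close>.
\<close>

lemma ln_ln_6_bounds: "177 / 100 \<le> ln (6::real)" "113 / 200 \<le> ln (177 / 100 :: real)"
proof -
  have "307 / 443 \<le> ln (2::real)"
    using ln_approx_bounds[of 2 3] by (simp add: eval_nat_numeral)
  moreover have "109 / 100 \<le> ln (3::real)"
    using ln_approx_bounds[of 3 3] by (simp add: eval_nat_numeral)
  moreover have "ln (6::real) = ln 2 + ln 3" using ln_mult[of 2 "3::real"] by simp
  ultimately show "177 / 100 \<le> ln (6::real)" by simp
  show "113 / 200 \<le> ln (177 / 100 :: real)"
    using ln_approx_bounds[of "177/100" 2] by (simp add: eval_nat_numeral)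
qed

lemma ln_ln_double_max3_nonneg: "0 \<le> ln (ln (2 * real (max 3 d)))"
proof -
  have "ln 6 \<le> ln (2 * real (max 3 d))" by (intro ln_mono) auto
  then have "1 \<le> ln (2 * real (max 3 d))" using ln_ln_6_bounds(1) by linarith
  then show ?thesis by (rule ln_ge_zero)
qed

text \<open>
  With \<open>u = ln (2 * t)\<close>, the derivative at \<open>t\<close> has the sign of \<open>1 / u - ln u\<close>, which is negative
  as soon as \<open>u * ln u > 1\<close>. This holds from \<open>t = 3\<close> on but fails at \<open>t = 2\<close>, which is why
  the error bound contains \<open>max 3 d\<close>.
\<close>

lemma ln_ln_over_antimono:
  fixes x z :: real
  assumes "3 \<le> x" "x \<le> z"
  shows "ln (ln (2 * z)) / z \<le> ln (ln (2 * x)) / x"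
proof (rule DERIV_nonpos_imp_nonincreasing[OF assms(2)])
  fix t assume "x \<le> t" "t \<le> z"
  then have t: "t \<ge> 3" using assms by simp
  define u where "u = ln (2 * t)"
  have "ln 6 \<le> u" unfolding u_def using t by (intro ln_mono) auto
  then have u: "177 / 100 \<le> u" using ln_ln_6_bounds(1) by linarith
  then have "ln (177 / 100) \<le> ln u" by (intro ln_mono) auto
  then have "113 / 200 \<le> ln u" using ln_ln_6_bounds(2) by linarith
  then have "177 / 100 * (113 / 200) \<le> u * ln u" using u by (intro mult_mono) auto
  then have neg: "1 / u - ln u \<le> 0" using u by (simp add: field_simps)
  have "((\<lambda>t. ln (ln (2 * t)) / t) has_real_derivative (1 / u - ln u) / t\<^sup>2) (at t)"
    using t u unfolding u_def
    by (auto intro!: derivative_eq_intros simp: field_simps power2_eq_square)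
  then show "\<exists>y. ((\<lambda>t. ln (ln (2 * t)) / t) has_real_derivative y) (at t) \<and> y \<le> 0"
    using neg t by (intro exI[of _ "(1 / u - ln u) / t\<^sup>2"]) (auto simp: divide_nonpos_pos)
qed

text \<open>
  Among the integers the maximum of \<open>ln (ln (2 * L)) / L\<close> is attained at \<open>3\<close>; the two values
  below it are compared numerically.
\<close>

lemma ln_ln_over_le_max3:
  fixes d L :: nat
  assumes "1 \<le> d" "d \<le> L"
  shows "ln (ln (2 * real L)) / real L \<le> ln (ln (2 * real (max 3 d))) / real (max 3 d)"
proof (cases "3 \<le> L")
  case True
  then show ?thesis using assms by (intro ln_ln_over_antimono) auto
next
  case False
  have "ln (177 / 100) \<le> ln (ln (6::real))" using ln_ln_6_bounds(1) by (intro ln_mono) auto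
  then have six: "113 / 200 \<le> ln (ln (6::real))" using ln_ln_6_bounds(2) by linarith
  have d: "max 3 d = 3" using False assms by auto
  consider "L = 1" | "L = 2" using False assms by linarith
  then show ?thesis
  proof cases
    case 1
    have "ln (ln (2::real)) \<le> 0" using ln_2_less_1 by (subst ln_le_zero_iff) auto
    then have "ln (ln (2 * real L)) / real L \<le> 0" using 1 by simp
    also have "0 \<le> ln (ln (2 * real (max 3 d))) / real (max 3 d)" using d ln_ln_6_bounds(1) by simp
    finally show ?thesis .
  next
    case 2
    have "ln (4::real) = 2 * ln 2" using ln_realpow[of 2 2] by simp
    then have "ln (4::real) \<le> 7 / 5" using ln2_le_25_over_36 by simp
    then have "ln (ln (4::real)) \<le> ln (7 / 5)" by (intro ln_mono) auto
    also have "\<dots> \<le> 7 / 20"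
      using ln_approx_bounds[of "7/5" 1] by (simp add: eval_nat_numeral)
    finally show ?thesis using 2 d six by simp
  qed
qed

lemma ln_2_mult_ge:
  assumes "1 \<le> t" shows "ln 2 \<le> ln (2 * real t)"
  using assms by (intro ln_mono) auto

lemma ln_over_delta:
  assumes "0 < \<delta>" "1 \<le> t"
  shows "ln (ln (2 * real t) / \<delta>) = ln (ln (2 * real t)) + ln (1 / \<delta>)"
proof -
  have "0 < ln (2 * real t)" using assms by (intro ln_gt_zero) auto
  then show ?thesis using assms by (simp add: ln_div)
qed

text \<open>
  Used for intervals that reach one end of the piece: these have at least \<open>d\<close> points, and the
  square of the barrier divided by the length is the sum of a term \<open>ln (ln (2 * L)) / L\<close>, largest
  at \<open>max 3 d\<close>, and a term \<open>ln (1 / \<delta>) / L\<close>, largest at \<open>d\<close>, up to the factor \<open>16 * \<sigma>\<^sup>2\<close>.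
\<close>

lemma lil_bound_le_mean_bound:
  assumes \<sigma>: "\<sigma> > 0" and \<delta>: "0 < \<delta>" "\<delta> < 1" and d: "1 \<le> d" "d \<le> L"
  shows "lil_bound \<sigma> \<delta> L \<le> real L *
    (4 * \<sigma> * (sqrt (ln (ln (2 * real (max 3 d))) / real (max 3 d)) + sqrt (ln (1 / \<delta>) / real d)))"
proof -
  define A where "A = ln (ln (2 * real (max 3 d))) / real (max 3 d)"
  define B where "B = ln (1 / \<delta>) / real d"
  have l: "0 \<le> ln (1 / \<delta>)" using \<delta> by simp
  have A: "0 \<le> A" unfolding A_def by (intro divide_nonneg_nonneg ln_ln_double_max3_nonneg) auto
  have B: "0 \<le> B" using l by (simp add: B_def)
  have "ln (ln (2 * real L) / \<delta>) / real L = ln (ln (2 * real L)) / real L + ln (1 / \<delta>) / real L"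
    using d \<delta> by (subst ln_over_delta) (auto simp: add_divide_distrib)
  also have "\<dots> \<le> A + B" unfolding A_def B_def using d l
    by (intro add_mono ln_ln_over_le_max3 divide_left_mono) auto
  finally have "sqrt (ln (ln (2 * real L) / \<delta>) / real L) \<le> sqrt (A + B)"
    by (rule real_sqrt_le_mono)
  also have "\<dots> \<le> sqrt A + sqrt B" using A B by (rule sqrt_add_le_add_sqrt)
  finally have "real L * (4 * \<sigma> * sqrt (ln (ln (2 * real L) / \<delta>) / real L))
      \<le> real L * (4 * \<sigma> * (sqrt A + sqrt B))"
    using \<sigma> by (intro mult_left_mono) auto
  moreover have "sqrt (real L * x) = real L * sqrt (x / real L)" for x
    using d by (simp add: real_sqrt_divide real_sqrt_mult field_simps)
  then have "lil_bound \<sigma> \<delta> L = real L * (4 * \<sigma> * sqrt (ln (ln (2 * real L) / \<delta>) / real L))"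
    by (simp only: lil_bound_def mult.left_commute)
  ultimately show ?thesis by (simp only: A_def B_def)
qed

text \<open>
  Used for intervals inside the piece, which may be short. The arithmetic-geometric mean
  inequality trades the square root of \<open>t\<close> for one \<open>lam\<close>, to be paid by the drop in total
  variation at one end of the interval, and a term linear in \<open>t\<close>, which is a mean error independent
  of the length.
\<close>

lemma lil_bound_le_penalty:
  assumes \<sigma>: "\<sigma> > 0" and lam: "lam > 0" and \<delta>: "0 < \<delta>" "\<delta> \<le> ln 2" and t: "t \<le> m"
  shows "lil_bound \<sigma> \<delta> t
    \<le> lam + real t * (4 * \<sigma>\<^sup>2 * ((ln (ln (2 * real m)) + ln (1 / \<delta>)) / lam))"
proof (cases "t = 0")
  case True
  then show ?thesis using lam by (simp add: lil_bound_def)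
next
  case False
  define Q where "Q = ln (ln (2 * real m) / \<delta>)"
  define w where "w = sqrt (real t * Q)"
  have "ln (ln (2 * real t) / \<delta>) \<le> Q"
    unfolding Q_def using False t \<delta> by (intro ln_mono divide_right_mono) (auto intro!: divide_pos_pos ln_gt_zero)
  then have "lil_bound \<sigma> \<delta> t \<le> 4 * \<sigma> * w"
    unfolding lil_bound_def w_def using \<sigma> by (intro mult_left_mono real_sqrt_le_mono) auto
  also have "\<dots> \<le> lam + 4 * \<sigma>\<^sup>2 * w\<^sup>2 / lam"
  proof -
    have "0 \<le> (lam - 2 * \<sigma> * w)\<^sup>2 / lam" using lam by simp
    also have "\<dots> = lam + 4 * \<sigma>\<^sup>2 * w\<^sup>2 / lam - 4 * \<sigma> * w"
      using lam by (simp add: power2_eq_square field_simps)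
    finally show ?thesis by simp
  qed
  also have "w\<^sup>2 = real t * Q"
  proof -
    have "ln 2 \<le> ln (2 * real m)" using False t by (intro ln_2_mult_ge) simp
    then have "\<delta> \<le> ln (2 * real m)" using \<delta> by linarith
    then have "0 \<le> Q" unfolding Q_def using \<delta> by (simp add: le_divide_eq_1_pos)
    then show ?thesis by (simp add: w_def)
  qed
  also have "Q = ln (ln (2 * real m)) + ln (1 / \<delta>)"
    unfolding Q_def using False t \<delta> by (intro ln_over_delta) auto
  finally show ?thesis by (simp add: mult_ac)
qed

section \<open>The error on a piece with controlled noise\<close>

text \<open>
  The intervals are exactly the ones for which the following error analysis evaluates the noise:
  they start at \<open>a\<close> or right after \<open>i\<close>, or end at \<open>b\<close> or \<open>i\<close>, so that their sums are the
  positions of four random walks.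
\<close>

definition noise_controlled ::
    "real \<Rightarrow> real \<Rightarrow> nat \<Rightarrow> nat \<Rightarrow> nat \<Rightarrow> (nat \<Rightarrow> real) \<Rightarrow> bool" where
  "noise_controlled \<sigma> \<delta> a b i e \<longleftrightarrow>
     (\<forall>k\<in>{a..b}. (\<Sum>l=a..k. e l) \<le> lil_bound \<sigma> \<delta> (k + 1 - a)) \<and>
     (\<forall>j\<in>{a..b}. (\<Sum>l=j..b. e l) \<le> lil_bound \<sigma> \<delta> (b + 1 - j)) \<and>
     (\<forall>j\<in>{a..i}. (\<Sum>l=j..i. e l) \<le> lil_bound \<sigma> \<delta> (i + 1 - j)) \<and>
     (\<forall>k\<in>{i + 1..b}. (\<Sum>l=i + 1..k. e l) \<le> lil_bound \<sigma> \<delta> (k - i)) \<and>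
     (\<Sum>l=a..b. e l) \<le> 2 * sqrt (real (b + 1 - a) * \<sigma>\<^sup>2 * ln (1 / \<delta>))"

text \<open>
  Let \<open>{j..k}\<close> be the maximal interval around \<open>i\<close> in the piece \<open>{a..b}\<close> on which \<open>f\<close> is at least
  \<open>f i\<close>. Lowering \<open>f\<close> there cannot decrease the objective, so the noise on the interval, plus
  \<open>lam\<close> times the change of the total variation, is at least its length times \<open>f i - c\<close>. Each end
  that is not an end of the piece gains \<open>lam\<close>, each other end costs at most \<open>lam\<close>. The three
  summands of the error bound correspond to intervals that touch exactly one end of the piece, to
  those inside it, and to the whole piece.
\<close>

lemma tv_error_upper:
  fixes f y e :: "nat \<Rightarrow> real"
  assumes min: "is_arg_min (tv_objective n lam y) (\<lambda>_. True) f"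
    and lam: "lam > 0" and \<sigma>: "\<sigma> > 0" and \<delta>: "0 < \<delta>" "\<delta> \<le> ln 2"
    and abi: "1 \<le> a" "a \<le> i" "i \<le> b" "b \<le> n"
    and y: "\<And>l. l \<in> {a..b} \<Longrightarrow> y l = c + e l"
    and noise: "noise_controlled \<sigma> \<delta> a b i e"
  shows "f i - c \<le> error_bound \<sigma> lam \<delta> (min (i + 1 - a) (b + 1 - i)) (b + 1 - a)"
proof -
  define m where "m = b + 1 - a"
  define d where "d = min (i + 1 - a) (b + 1 - i)"
  define E1 where "E1 = 4 * \<sigma> * (sqrt (ln (ln (2 * real (max 3 d))) / real (max 3 d)) + sqrt (ln (1 / \<delta>) / real d))"
  define E2 where "E2 = 4 * \<sigma>\<^sup>2 * ((ln (ln (2 * real m)) + ln (1 / \<delta>)) / lam)"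
  define E3 where "E3 = (2 * sqrt (real m * \<sigma>\<^sup>2 * ln (1 / \<delta>)) + 2 * lam) / real m"
  have m: "1 \<le> m" and d: "1 \<le> d" using abi by (auto simp: m_def d_def)
  have \<delta>1: "\<delta> < 1" using \<delta> ln_2_less_1 by linarith
  have E1: "0 \<le> E1" unfolding E1_def using \<sigma> \<delta> \<delta>1
    by (intro mult_nonneg_nonneg add_nonneg_nonneg real_sqrt_ge_zero divide_nonneg_nonneg
        ln_ln_double_max3_nonneg) auto
  have E2: "0 \<le> E2"
  proof -
    have "ln 2 \<le> ln (2 * real m)" using m by (rule ln_2_mult_ge)
    then have "0 \<le> ln (ln (2 * real m) / \<delta>)" using \<delta> by (intro ln_ge_zero) (simp add: le_divide_eq_1_pos)
    then show ?thesis unfolding E2_def using lam \<delta> m by (subst (asm) ln_over_delta) auto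
  qed
  have E3: "0 \<le> E3" unfolding E3_def using lam \<delta> \<delta>1
    by (intro divide_nonneg_nonneg add_nonneg_nonneg mult_nonneg_nonneg real_sqrt_ge_zero) auto
  obtain j k where jk: "a \<le> j" "j \<le> i" "i \<le> k" "k \<le> b" and above: "\<And>l. l \<in> {j..k} \<Longrightarrow> f i \<le> f l"
    and left: "j = a \<or> f (j - 1) < f i" and right: "k = b \<or> f (k + 1) < f i"
    using maximal_superlevel_interval[OF abi(2,3), of f] by metis
  define L where "L = k + 1 - j"
  define cl where "cl = (if j = a then 1 else - 1 :: real)"
  define cr where "cr = (if k = b then 1 else - 1 :: real)"
  have L: "0 < real L" using jk by (simp add: L_def)
  have key: "real L * (f i - c) \<le> (\<Sum>l=j..k. e l) + lam * (cl + cr)"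
  proof -
    have "f i \<le> f j" "f i \<le> f k" using above[of j] above[of k] jk by auto
    then have "0 \<le> (\<Sum>l=j..k. y l - f l) + lam * (cl + cr)"
      using jk abi left right lam
      by (intro tv_lower_interval[OF min]) (auto simp: cl_def cr_def)
    also have "(\<Sum>l=j..k. y l - f l) \<le> (\<Sum>l=j..k. e l - (f i - c))"
    proof (rule sum_mono)
      fix l assume l: "l \<in> {j..k}"
      then have "l \<in> {a..b}" using jk by auto
      from y[OF this] above[OF l] show "y l - f l \<le> e l - (f i - c)" by simp
    qed
    finally show ?thesis by (simp add: sum_subtractf L_def)
  qed
  have conclude: "f i - c \<le> E1 + E2 + E3"
    if "(\<Sum>l=j..k. e l) + lam * (cl + cr) \<le> real L * E" "E \<in> {E1, E2, E3}" for E
  proof -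
    have "real L * (f i - c) \<le> real L * E" using key that(1) by linarith
    then have "f i - c \<le> E" using L by simp
    then show ?thesis using that(2) E1 E2 E3 by auto
  qed
  consider (whole) "j = a" "k = b" | (left) "j = a" "k \<noteq> b" | (right) "j \<noteq> a" "k = b"
    | (inner) "j \<noteq> a" "k \<noteq> b" by blast
  then have "f i - c \<le> E1 + E2 + E3"
  proof cases
    case whole
    then have "(\<Sum>l=j..k. e l) \<le> 2 * sqrt (real m * \<sigma>\<^sup>2 * ln (1 / \<delta>))"
      using noise by (simp add: noise_controlled_def m_def)
    then have "(\<Sum>l=j..k. e l) + lam * (cl + cr) \<le> real L * E3"
      using whole m by (simp add: cl_def cr_def E3_def L_def m_def)
    then show ?thesis by (rule conclude) simp
  next
    case left
    then have "(\<Sum>l=j..k. e l) \<le> lil_bound \<sigma> \<delta> L"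
      using noise jk by (auto simp: noise_controlled_def L_def)
    also have "\<dots> \<le> real L * E1" unfolding E1_def using \<sigma> \<delta> \<delta>1 d left jk
      by (intro lil_bound_le_mean_bound) (auto simp: d_def L_def)
    finally have "(\<Sum>l=j..k. e l) + lam * (cl + cr) \<le> real L * E1"
      using left by (simp add: cl_def cr_def)
    then show ?thesis by (rule conclude) simp
  next
    case right
    then have "(\<Sum>l=j..k. e l) \<le> lil_bound \<sigma> \<delta> L"
      using noise jk by (auto simp: noise_controlled_def L_def)
    also have "\<dots> \<le> real L * E1" unfolding E1_def using \<sigma> \<delta> \<delta>1 d right jk
      by (intro lil_bound_le_mean_bound) (auto simp: d_def L_def)
    finally have "(\<Sum>l=j..k. e l) + lam * (cl + cr) \<le> real L * E1"
      using right by (simp add: cl_def cr_def)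
    then show ?thesis by (rule conclude) simp
  next
    case inner
    \<comment> \<open>Starting two walks at \<open>i\<close> covers all intervals around \<open>i\<close>, and each walk uses up one of
      the two \<open>lam\<close> gained at the ends.\<close>
    have split: "(\<Sum>l=j..k. e l) = (\<Sum>l=j..i. e l) + (\<Sum>l=i + 1..k. e l)"
      using jk sum.ub_add_nat[of j i e "k - i"] by simp
    have "(\<Sum>l=j..i. e l) \<le> lil_bound \<sigma> \<delta> (i + 1 - j)"
      using noise jk by (auto simp: noise_controlled_def)
    also have "\<dots> \<le> lam + real (i + 1 - j) * E2"
      unfolding E2_def using \<sigma> lam \<delta> jk by (intro lil_bound_le_penalty) (auto simp: m_def)
    finally have 1: "(\<Sum>l=j..i. e l) \<le> lam + real (i + 1 - j) * E2" .
    have "(\<Sum>l=i + 1..k. e l) \<le> lil_bound \<sigma> \<delta> (k - i)"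
    proof (cases "k = i")
      case True
      then show ?thesis by (simp add: lil_bound_def)
    next
      case False
      then show ?thesis using noise jk by (auto simp: noise_controlled_def)
    qed
    also have "\<dots> \<le> lam + real (k - i) * E2"
      unfolding E2_def using \<sigma> lam \<delta> jk abi by (intro lil_bound_le_penalty) (auto simp: m_def)
    finally have 2: "(\<Sum>l=i + 1..k. e l) \<le> lam + real (k - i) * E2" .
    have "real L = real (i + 1 - j) + real (k - i)" using jk by (simp add: L_def)
    then have "(\<Sum>l=j..k. e l) + lam * (cl + cr) \<le> real L * E2"
      using 1 2 split inner by (simp add: cl_def cr_def distrib_right)
    then show ?thesis by (rule conclude) simp
  qed
  then show ?thesis by (simp add: error_bound_def E1_def E2_def E3_def m_def d_def)
qed

section \<open>The probability that the noise is controlled\<close>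

text \<open>
  The walks of interest run forwards or backwards from a given index, hence the injection \<open>\<pi>\<close>.
  The exceptional event is exhibited as a measurable set since the estimator, about which nothing
  but optimality is known, need not be measurable.
\<close>

lemma (in prob_space) finite_lil_injective_walk:
  fixes \<epsilon> :: "nat \<Rightarrow> 'a \<Rightarrow> real"
  assumes indep: "indep_vars (\<lambda>_. borel) \<epsilon> I"
    and mgf: "\<And>l s. l \<in> I \<Longrightarrow>
      (\<integral>\<^sup>+\<omega>. ennreal (exp (s * \<epsilon> l \<omega>)) \<partial>M) \<le> ennreal (exp (\<sigma>\<^sup>2 * s\<^sup>2 / 2))"
    and \<pi>: "inj_on \<pi> {..<T}" "\<pi> ` {..<T} \<subseteq> I"
    and \<sigma>: "\<sigma> > 0" and \<delta>: "0 < \<delta>" "\<delta> \<le> ln 2"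
  obtains G where "G \<in> events" "prob G \<le> 2 * (\<delta> / ln 2) ^ 4"
    "\<And>\<omega> t. \<omega> \<in> space M - G \<Longrightarrow> t \<in> {1..T} \<Longrightarrow> (\<Sum>r<t. \<epsilon> (\<pi> r) \<omega>) \<le> lil_bound \<sigma> \<delta> t"
proof -
  let ?G = "{\<omega>\<in>space M. \<exists>t\<in>{1..T}. lil_bound \<sigma> \<delta> t < (\<Sum>r<t. \<epsilon> (\<pi> r) \<omega>)}"
  have ind: "indep_vars (\<lambda>_. borel) (\<lambda>r. \<epsilon> (\<pi> r)) {..<T}"
    by (rule indep_vars_reindex[OF indep \<pi>])
  then have m: "(\<lambda>\<omega>. \<epsilon> (\<pi> r) \<omega>) \<in> borel_measurable M" if "r < T" for r
    using that by (auto simp: indep_vars_def)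
  have "?G \<in> events"
    by (intro sets.sets_Collect_finite_Ex borel_measurable_less borel_measurable_sum m) auto
  moreover have "prob ?G \<le> 2 * (\<delta> / ln 2) ^ 4"
    using \<pi>(2) by (intro finite_lil_upper ind mgf \<sigma> \<delta>) auto
  ultimately show ?thesis by (intro that[of ?G]) (auto simp: not_less)
qed

text \<open>
  Each of the four walks fails with probability at most \<open>2 * (\<delta> / ln 2) ^ 4\<close>, and the sum over the
  whole piece exceeds its bound with probability at most \<open>\<delta>\<^sup>2\<close>.
\<close>

lemma (in prob_space) noise_controlled_event:
  fixes \<epsilon> :: "nat \<Rightarrow> 'a \<Rightarrow> real"
  assumes indep: "indep_vars (\<lambda>_. borel) \<epsilon> {a..b}"
    and mgf: "\<And>l s. l \<in> {a..b} \<Longrightarrow>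
      (\<integral>\<^sup>+\<omega>. ennreal (exp (s * \<epsilon> l \<omega>)) \<partial>M) \<le> ennreal (exp (\<sigma>\<^sup>2 * s\<^sup>2 / 2))"
    and \<sigma>: "\<sigma> > 0" and \<delta>: "0 < \<delta>" "\<delta> \<le> ln 2" and i: "a \<le> i" "i \<le> b"
  obtains G where "G \<in> events" "prob G \<le> \<delta>\<^sup>2 + 8 * (\<delta> / ln 2) ^ 4"
    "\<And>\<omega>. \<omega> \<in> space M - G \<Longrightarrow> noise_controlled \<sigma> \<delta> a b i (\<lambda>l. \<epsilon> l \<omega>)"
proof -
  note walk = finite_lil_injective_walk[OF indep mgf _ _ \<sigma> \<delta>]
  define m where "m = b + 1 - a"
  obtain G1 where G1: "G1 \<in> events" "prob G1 \<le> 2 * (\<delta> / ln 2) ^ 4"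
    "\<And>\<omega> t. \<omega> \<in> space M - G1 \<Longrightarrow> t \<in> {1..m} \<Longrightarrow> (\<Sum>r<t. \<epsilon> (a + r) \<omega>) \<le> lil_bound \<sigma> \<delta> t"
    by (rule walk[of "\<lambda>r. a + r" m]) (use i in \<open>auto simp: m_def inj_on_def\<close>)
  obtain G2 where G2: "G2 \<in> events" "prob G2 \<le> 2 * (\<delta> / ln 2) ^ 4"
    "\<And>\<omega> t. \<omega> \<in> space M - G2 \<Longrightarrow> t \<in> {1..m} \<Longrightarrow> (\<Sum>r<t. \<epsilon> (b - r) \<omega>) \<le> lil_bound \<sigma> \<delta> t"
    by (rule walk[of "\<lambda>r. b - r" m]) (use i in \<open>auto simp: m_def inj_on_def\<close>)
  obtain G3 where G3: "G3 \<in> events" "prob G3 \<le> 2 * (\<delta> / ln 2) ^ 4"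
    "\<And>\<omega> t. \<omega> \<in> space M - G3 \<Longrightarrow> t \<in> {1..i + 1 - a} \<Longrightarrow> (\<Sum>r<t. \<epsilon> (i - r) \<omega>) \<le> lil_bound \<sigma> \<delta> t"
    by (rule walk[of "\<lambda>r. i - r" "i + 1 - a"]) (use i in \<open>auto simp: inj_on_def\<close>)
  obtain G4 where G4: "G4 \<in> events" "prob G4 \<le> 2 * (\<delta> / ln 2) ^ 4"
    "\<And>\<omega> t. \<omega> \<in> space M - G4 \<Longrightarrow> t \<in> {1..b - i} \<Longrightarrow> (\<Sum>r<t. \<epsilon> (i + 1 + r) \<omega>) \<le> lil_bound \<sigma> \<delta> t"
    by (rule walk[of "\<lambda>r. i + 1 + r" "b - i"]) (use i in \<open>auto simp: inj_on_def\<close>)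
  define z where "z = 2 * sqrt (real m * \<sigma>\<^sup>2 * ln (1 / \<delta>))"
  define G5 where "G5 = {\<omega>\<in>space M. \<exists>t\<in>{1..m}. z \<le> (\<Sum>r<t. \<epsilon> (a + r) \<omega>)}"
  have m: "1 \<le> m" using i by (simp add: m_def)
  have l: "0 < ln (1 / \<delta>)" using \<delta> ln_2_less_1 by (intro ln_gt_zero) (auto simp: field_simps)
  have ind5: "indep_vars (\<lambda>_. borel) (\<lambda>r. \<epsilon> (a + r)) {..<m}"
    by (rule indep_vars_reindex[OF indep]) (use i in \<open>auto simp: m_def\<close>)
  have m5: "(\<lambda>\<omega>. \<epsilon> (a + r) \<omega>) \<in> borel_measurable M" if "r < m" for r
    using ind5 that by (auto simp: indep_vars_def)
  have G5: "G5 \<in> events" unfolding G5_def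
    by (intro sets.sets_Collect_finite_Ex borel_measurable_le borel_measurable_sum m5) auto
  have "prob G5 \<le> exp (- (z\<^sup>2 / (2 * \<sigma>\<^sup>2 * real m)))"
    unfolding G5_def using \<sigma> m l i
    by (intro subgaussian_maximal_inequality[OF ind5] mgf) (auto simp: z_def m_def)
  also have "z\<^sup>2 / (2 * \<sigma>\<^sup>2 * real m) = 2 * ln (1 / \<delta>)"
    using \<sigma> m l by (simp add: z_def power_mult_distrib field_simps)
  also have "exp (- (2 * ln (1 / \<delta>))) = (exp (ln \<delta>))\<^sup>2"
    using \<delta> exp_double[of "ln \<delta>"] by (simp add: ln_div)
  also have "\<dots> = \<delta>\<^sup>2" using \<delta> by simp
  finally have P5: "prob G5 \<le> \<delta>\<^sup>2" .
  define G where "G = G1 \<union> (G2 \<union> (G3 \<union> (G4 \<union> G5)))"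
  have "prob G \<le> prob G1 + (prob G2 + (prob G3 + (prob G4 + prob G5)))"
    unfolding G_def using G1(1) G2(1) G3(1) G4(1) G5
    by (intro order_trans[OF measure_Un_le] add_left_mono) auto
  then have PG: "prob G \<le> \<delta>\<^sup>2 + 8 * (\<delta> / ln 2) ^ 4"
    using G1(2) G2(2) G3(2) G4(2) P5 by linarith
  have "G \<in> events" unfolding G_def using G1(1) G2(1) G3(1) G4(1) G5 by auto
  moreover note PG
  moreover have "noise_controlled \<sigma> \<delta> a b i (\<lambda>l. \<epsilon> l \<omega>)" if \<omega>: "\<omega> \<in> space M - G" for \<omega>
  proof -
    have fwd: "(\<Sum>l=p..k. \<epsilon> l \<omega>) = (\<Sum>r<k + 1 - p. \<epsilon> (p + r) \<omega>)" for p k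
      by (rule sum.reindex_bij_witness[of _ "\<lambda>r. p + r" "\<lambda>l. l - p"]) auto
    have bwd: "(\<Sum>l=j..p. \<epsilon> l \<omega>) = (\<Sum>r<p + 1 - j. \<epsilon> (p - r) \<omega>)" for j p
      by (rule sum.reindex_bij_witness[of _ "\<lambda>r. p - r" "\<lambda>l. p - l"]) auto
    have "(\<Sum>l=a..k. \<epsilon> l \<omega>) \<le> lil_bound \<sigma> \<delta> (k + 1 - a)" if "k \<in> {a..b}" for k
      unfolding fwd using that \<omega> by (intro G1(3)) (auto simp: G_def m_def)
    moreover have "(\<Sum>l=j..b. \<epsilon> l \<omega>) \<le> lil_bound \<sigma> \<delta> (b + 1 - j)" if "j \<in> {a..b}" for j
      unfolding bwd using that \<omega> by (intro G2(3)) (auto simp: G_def m_def)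
    moreover have "(\<Sum>l=j..i. \<epsilon> l \<omega>) \<le> lil_bound \<sigma> \<delta> (i + 1 - j)" if "j \<in> {a..i}" for j
      unfolding bwd using that \<omega> by (intro G3(3)) (auto simp: G_def)
    moreover have "(\<Sum>l=i + 1..k. \<epsilon> l \<omega>) \<le> lil_bound \<sigma> \<delta> (k - i)" if "k \<in> {i + 1..b}" for k
    proof -
      have "k - i \<in> {1..b - i}" using that by auto
      then show ?thesis using \<omega> G4(3)[of \<omega> "k - i"] unfolding fwd by (auto simp: G_def)
    qed
    moreover have "(\<Sum>l=a..b. \<epsilon> l \<omega>) \<le> z"
    proof -
      have "\<omega> \<notin> G5" "\<omega> \<in> space M" using \<omega> by (auto simp: G_def)
      then have "(\<Sum>r<m. \<epsilon> (a + r) \<omega>) < z" using m by (auto simp: G5_def not_le)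
      then show ?thesis unfolding fwd m_def by simp
    qed
    ultimately show ?thesis unfolding noise_controlled_def z_def m_def by blast
  qed
  ultimately show ?thesis by (rule that)
qed

section \<open>The two-sided bound\<close>

lemma tv_objective_uminus: "tv_objective n lam (\<lambda>l. - y l) (\<lambda>l. - f l) = tv_objective n lam y f"
proof -
  have "(- y l - - f l)\<^sup>2 = (y l - f l)\<^sup>2" for l by (simp add: power2_eq_square algebra_simps)
  moreover have "\<bar>- f l - - f (l + 1)\<bar> = \<bar>f l - f (l + 1)\<bar>" for l by simp
  ultimately show ?thesis unfolding tv_objective_def by (simp only:)
qed

lemma tv_minimizer_uminus:
  assumes "is_arg_min (tv_objective n lam y) (\<lambda>_. True) f"
  shows "is_arg_min (tv_objective n lam (\<lambda>l. - y l)) (\<lambda>_. True) (\<lambda>l. - f l)"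
proof -
  have "tv_objective n lam (\<lambda>l. - y l) g = tv_objective n lam y (\<lambda>l. - g l)" for g
    using tv_objective_uminus[of n lam y "\<lambda>l. - g l"] by simp
  then show ?thesis using assms by (simp add: is_arg_min_def)
qed

theorem theorem4:
  fixes M :: "'a measure"
    and n K i :: nat
    and N :: "nat \<Rightarrow> nat"
    and lam \<sigma> \<delta> :: real
    and \<theta> :: "nat \<Rightarrow> real"
    and \<epsilon> y :: "nat \<Rightarrow> 'a \<Rightarrow> real"
    and \<theta>hat :: "'a \<Rightarrow> nat \<Rightarrow> real"
  assumes "prob_space M"
    and "lam > 0"
    and "\<sigma> > 0"
    and "piecewise_constant n K N \<theta>"
    and "prob_space.indep_vars M (\<lambda>_. borel) \<epsilon> {1..n}"
    and "\<And>j k. j \<in> {1..n} \<Longrightarrow> k \<in> {1..n} \<Longrightarrow> distr M borel (\<epsilon> j) = distr M borel (\<epsilon> k)"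
    and "\<And>j. j \<in> {1..n} \<Longrightarrow> sub_gaussian M \<sigma> (\<epsilon> j)"
    and "\<And>j. j \<in> {1..n} \<Longrightarrow> integral\<^sup>L M (\<epsilon> j) = 0"
    and "\<And>j \<omega>. j \<in> {1..n} \<Longrightarrow> \<omega> \<in> space M \<Longrightarrow> y j \<omega> = \<theta> j + \<epsilon> j \<omega>"
    and "\<And>\<omega>. \<omega> \<in> space M \<Longrightarrow>
           is_arg_min (tv_objective n lam (\<lambda>j. y j \<omega>)) (\<lambda>_. True) (\<theta>hat \<omega>)"
    and "i \<in> {1..n}"
    and "0 < \<delta>" and "\<delta> < ln 2 / exp 1"
  shows "measure M {\<omega> \<in> space M. \<bar>\<theta>hat \<omega> i - \<theta> i\<bar> >
             error_bound \<sigma> lam \<delta> (boundary_dist K N i) (piece_length N (piece_index K N i))}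
           \<le> 2 * (1 + 24 / (ln 2)\<^sup>2) * \<delta>\<^sup>2"
proof -
  interpret prob_space M by fact
  define p where "p = piece_index K N i"
  define a where "a = N p"
  define b where "b = N (p + 1) - 1"
  have "p \<in> {1..K} \<and> N p \<le> i \<and> i \<le> N (p + 1) - 1"
    using theI'[OF piece_index_unique[OF assms(4,11)]]
    unfolding p_def piece_index_def .
  then have p: "p \<in> {1..K}" and ai: "a \<le> i" and ib: "i \<le> b" by (auto simp: a_def b_def)
  have pc: "N 1 = 1" "N K < n" "N (K + 1) = n + 1" "strict_mono_on {1..K} N"
    and const: "\<And>k j. k \<in> {1..K} \<Longrightarrow> j \<in> {N k..<N (k + 1)} \<Longrightarrow> \<theta> j = \<theta> (N k)"
    using assms(4) unfolding piecewise_constant_def by blast+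
  have mono: "N k \<le> N k'" if "k \<in> {1..K}" "k' \<in> {1..K}" "k \<le> k'" for k k'
    using strict_mono_on_leD[OF pc(4)] that by blast
  have a1: "1 \<le> a" using mono[of 1 p] p pc by (simp add: a_def)
  have bn: "b \<le> n"
  proof (cases "p = K")
    case False
    then have "N (p + 1) \<le> N K" using p by (intro mono) auto
    then show ?thesis using pc by (simp add: b_def)
  next
    case True
    then show ?thesis using pc(3) by (simp add: b_def)
  qed
  have Nb: "N (p + 1) = b + 1" using a1 ai ib by (simp add: b_def)
  have dist: "boundary_dist K N i = min (i + 1 - a) (b + 1 - i)"
    using Nb by (simp add: boundary_dist_def p_def[symmetric] a_def)
  have len: "piece_length N p = b + 1 - a"
    using Nb by (simp add: piece_length_def a_def)
  have \<theta>: "\<theta> l = \<theta> i" if "l \<in> {a..b}" for l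
    using const[OF p, of l] const[OF p, of i] that ai ib Nb by (auto simp: a_def)
  have sub: "{a..b} \<subseteq> {1..n}" using a1 bn by auto
  have "ln 2 / exp 1 \<le> ln (2::real)" by (simp add: divide_le_eq)
  then have \<delta>: "0 < \<delta>" "\<delta> \<le> ln 2" using assms(12,13) by auto
  have mgf: "(\<integral>\<^sup>+\<omega>. ennreal (exp (s * \<epsilon> l \<omega>)) \<partial>M) \<le> ennreal (exp (\<sigma>\<^sup>2 * s\<^sup>2 / 2))"
    if l: "l \<in> {a..b}" for l s
  proof -
    have l': "l \<in> {1..n}" using l sub by blast
    have "integrable M (\<lambda>\<omega>. exp (s * \<epsilon> l \<omega>))"
      "integral\<^sup>L M (\<lambda>\<omega>. exp (s * \<epsilon> l \<omega>)) \<le> exp (\<sigma>\<^sup>2 * s\<^sup>2 / 2)"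
      using assms(7)[OF l'] assms(8)[OF l'] by (auto simp: sub_gaussian_def)
    then show ?thesis by (subst nn_integral_eq_integral) (auto intro: ennreal_leI)
  qed
  have ind: "indep_vars (\<lambda>_. borel) \<epsilon> {a..b}"
    by (rule indep_vars_subset[OF assms(5) sub])
  obtain G where G: "G \<in> events" "prob G \<le> \<delta>\<^sup>2 + 8 * (\<delta> / ln 2) ^ 4"
    "\<And>\<omega>. \<omega> \<in> space M - G \<Longrightarrow> noise_controlled \<sigma> \<delta> a b i (\<lambda>l. \<epsilon> l \<omega>)"
    using noise_controlled_event[OF ind mgf assms(3) \<delta> ai ib] by blast
  have ind': "indep_vars (\<lambda>_. borel) (\<lambda>l \<omega>. - \<epsilon> l \<omega>) {a..b}"
    by (rule indep_vars_compose2[OF ind]) simp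
  have mgf': "(\<integral>\<^sup>+\<omega>. ennreal (exp (s * - \<epsilon> l \<omega>)) \<partial>M) \<le> ennreal (exp (\<sigma>\<^sup>2 * s\<^sup>2 / 2))"
    if "l \<in> {a..b}" for l s
    using mgf[OF that, of "- s"] by simp
  \<comment> \<open>The lower error bound is the upper one for the negated data, with the negated noise.\<close>
  obtain H where H: "H \<in> events" "prob H \<le> \<delta>\<^sup>2 + 8 * (\<delta> / ln 2) ^ 4"
    "\<And>\<omega>. \<omega> \<in> space M - H \<Longrightarrow> noise_controlled \<sigma> \<delta> a b i (\<lambda>l. - \<epsilon> l \<omega>)"
    using noise_controlled_event[OF ind' mgf' assms(3) \<delta> ai ib] by blast
  let ?B = "error_bound \<sigma> lam \<delta> (boundary_dist K N i) (piece_length N (piece_index K N i))"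
  have good: "\<bar>\<theta>hat \<omega> i - \<theta> i\<bar> \<le> ?B" if \<omega>: "\<omega> \<in> space M" "\<omega> \<notin> G \<union> H" for \<omega>
  proof -
    have y: "y l \<omega> = \<theta> i + \<epsilon> l \<omega>" if "l \<in> {a..b}" for l
      using assms(9)[of l \<omega>] \<theta>[OF that] that sub \<omega> by auto
    then have y': "- y l \<omega> = - \<theta> i + - \<epsilon> l \<omega>" if "l \<in> {a..b}" for l
      using that by simp
    have G': "\<omega> \<in> space M - G" and H': "\<omega> \<in> space M - H" using \<omega> by auto
    note upper = tv_error_upper[OF _ assms(2,3) \<delta> a1 ai ib bn]
    have "\<theta>hat \<omega> i - \<theta> i \<le> ?B"
      unfolding dist p_def[symmetric] len
      by (rule upper[OF assms(10)[OF \<omega>(1)] y G(3)[OF G']])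
    moreover have "- \<theta>hat \<omega> i - (- \<theta> i) \<le> ?B"
      unfolding dist p_def[symmetric] len
      by (rule upper[OF tv_minimizer_uminus[OF assms(10)[OF \<omega>(1)]] y' H(3)[OF H']])
    ultimately show ?thesis by linarith
  qed
  have "measure M {\<omega> \<in> space M. \<bar>\<theta>hat \<omega> i - \<theta> i\<bar> > ?B} \<le> prob (G \<union> H)"
    using good G(1) H(1) by (intro finite_measure_mono) (auto simp: not_le[symmetric])
  also have "\<dots> \<le> prob G + prob H"
    using G(1) H(1) by (rule measure_Un_le)
  also have "\<dots> \<le> 2 * \<delta>\<^sup>2 + 16 * (\<delta> / ln 2) ^ 4" using G(2) H(2) by linarith
  also have "\<dots> \<le> 2 * \<delta>\<^sup>2 + 48 * (\<delta> / ln 2)\<^sup>2"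
  proof -
    have "(\<delta> / ln 2) ^ 4 \<le> (\<delta> / ln 2) ^ 2" using \<delta> by (intro power_decreasing) auto
    moreover have "0 \<le> (\<delta> / ln 2)\<^sup>2" by simp
    ultimately show ?thesis by linarith
  qed
  also have "\<dots> = 2 * (1 + 24 / (ln 2)\<^sup>2) * \<delta>\<^sup>2" by (simp add: power_divide algebra_simps)
  finally show ?thesis .
qed

end
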